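(* If $C$ is an extremal Type II code of length $n=48$ or $n=72$, and $w_0$ is the minimal nonzero weight of $C$ (so $w_0=12$ or $w_0=16$ respectively), then $C=\mathcal{C}_{w_0}(C)$; that is, $C$ is generated by its codewords of minimal weight $w_0$.
   Context: A binary linear code of length $n$ is a subspace $C\subseteq\mathbb{F}_2^n$; $\mathrm{wt}$ denotes Hamming weight. $C$ is of Type II if $C=C^\perp$ (with respect to $(v,w)=\sum_jv_jw_j$) and $4\mid\mathrm{wt}(c)$ for all $c\in C$. A Type II code of length $n$ is extremal if its minimal nonzero weight equals $4\lfloor n/24\rfloor+4$. $C_w$ is the set of codewords of $C$ of weight $w$, and $\mathcal{C}_w(C)$ is the linear subcode of $C$ generated by $C_w$. *)

theory Defs
  imports "HOL-Analysis.Analysis" "HOL-Library.Z2"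
begin

text \<open>
  A vector in \<open>bit ^ 'n\<close> is a binary word of length \<open>CARD('n)\<close>. Subspaces and spans over the field
  \<open>bit\<close> are \<open>vec.subspace\<close> and \<open>vec.span\<close>; the unqualified \<open>subspace\<close> and \<open>span\<close> are over the reals.
\<close>

type_synonym 'n code = "(bit ^ 'n) set"

definition linear_code :: "('n::finite) code \<Rightarrow> bool" where
  "linear_code C \<longleftrightarrow> vec.subspace C"

definition wt :: "bit ^ ('n::finite) \<Rightarrow> nat" where
  "wt v = card {j. v $ j \<noteq> 0}"

definition pairing :: "bit ^ ('n::finite) \<Rightarrow> bit ^ 'n \<Rightarrow> bit" where
  "pairing v w = (\<Sum>j\<in>UNIV. v $ j * w $ j)"

definition dual_code :: "('n::finite) code \<Rightarrow> 'n code" where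
  "dual_code C = {v. \<forall>w\<in>C. pairing v w = 0}"

definition type_II :: "('n::finite) code \<Rightarrow> bool" where
  "type_II C \<longleftrightarrow> linear_code C \<and> C = dual_code C \<and> (\<forall>c\<in>C. 4 dvd wt c)"

text \<open>The infimum in \<open>nat\<close> is attained unless \<open>C \<subseteq> {0}\<close>, in which case the value is \<open>0\<close>.\<close>

definition min_weight :: "('n::finite) code \<Rightarrow> nat" where
  "min_weight C = Inf (wt ` (C - {0}))"

definition extremal_type_II :: "('n::finite) code \<Rightarrow> bool" where
  "extremal_type_II C \<longleftrightarrow> type_II C \<and> min_weight C = 4 * (CARD('n) div 24) + 4"

definition words_of_weight :: "('n::finite) code \<Rightarrow> nat \<Rightarrow> 'n code" where
  "words_of_weight C w = {c \<in> C. wt c = w}"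

definition weight_subcode :: "('n::finite) code \<Rightarrow> nat \<Rightarrow> 'n code" where
  "weight_subcode C w = vec.span (words_of_weight C w)"

end

theory Submission
  imports Defs
begin

text \<open>
  A self-dual code whose nonzero words have weight at least \<open>d\<close> is an orthogonal array of strength
  \<open>d - 1\<close>: a polynomial of degree below \<open>d\<close> in the coordinates has the same average over \<open>C\<close> as over
  the whole space. Let \<open>c\<close> be a word of least weight outside the span of the words of weight \<open>d\<close>.
  Comparing \<open>c\<close> with \<open>c + v\<close> shows that every \<open>v\<close> of weight \<open>d\<close> meets \<open>c\<close> in an even number of at
  most \<open>d / 2\<close> coordinates. Take \<open>P\<close> with roots \<open>0, 2, \<dots>, d / 2\<close> and \<open>Q\<close> with roots the possible
  weights strictly between \<open>d\<close> and \<open>n\<close>. In the sum of \<open>P(|c \<inter> v|) Q(wt v)\<close> over \<open>v \<in> C\<close> only the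
  all-one word contributes, namely \<open>P(wt c) Q(n)\<close>. For \<open>n = 48, 72\<close> the degree of \<open>P Q\<close> is below \<open>d\<close>,
  so the sum is also \<open>2 ^ (n / 2)\<close> times an explicit average that depends only on \<open>wt c\<close>, and the
  two values differ for each possible weight of \<open>c\<close>.
\<close>

section \<open>Newton expansions\<close>

text \<open>The values \<open>\<beta>\<close> stay free, so that one coefficient list serves both
  for binomials and for their averages.\<close>

fun newton_sum :: "(nat \<Rightarrow> int) \<Rightarrow> nat \<Rightarrow> int list \<Rightarrow> int" where
  "newton_sum \<beta> k [] = 0"
| "newton_sum \<beta> k (c # cs) = c * \<beta> k + newton_sum \<beta> (Suc k) cs"

text \<open>Multiplication by \<open>y - r\<close>, from \<open>(y - r) (y choose k) = (k + 1) (y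
  choose (k + 1)) + (k - r) (y choose k)\<close>; \<open>b\<close> carries the preceding
  coefficient.\<close>

fun newton_mult :: "int \<Rightarrow> nat \<Rightarrow> int \<Rightarrow> int list \<Rightarrow> int list" where
  "newton_mult r k b [] = [int k * b]"
| "newton_mult r k b (c # cs) = (int k * b + (int k - r) * c) # newton_mult r (Suc k) c cs"

text \<open>The coefficients of \<open>monic_poly rs (s + y)\<close> in the basis \<open>y choose k\<close>.\<close>

fun newton_coeffs :: "int \<Rightarrow> int list \<Rightarrow> int list" where
  "newton_coeffs s [] = [1]"
| "newton_coeffs s (r # rs) = newton_mult (r - s) 0 0 (newton_coeffs s rs)"

definition monic_poly :: "int list \<Rightarrow> int \<Rightarrow> int" where
  "monic_poly rs x = (\<Prod>r\<leftarrow>rs. x - r)"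

text \<open>
  With \<open>P = monic_poly ps\<close> and \<open>Q = monic_poly qs\<close>, this is \<open>2 ^ (length ps + length qs)\<close> times the average
  of \<open>P(|S \<inter> x|) Q(|x|)\<close> over all subsets \<open>x\<close> of an \<open>n\<close>-set, where \<open>S\<close> is a fixed subset of size \<open>w\<close>;
  the power of two keeps it integral. \<open>Q\<close> is expanded in binomials of \<open>|x| - i\<close> because the factor
  \<open>|S \<inter> x| choose i\<close> picks \<open>i\<close> elements of \<open>x\<close>.
\<close>

definition moment :: "nat \<Rightarrow> nat \<Rightarrow> int list \<Rightarrow> int list \<Rightarrow> int" where
  "moment n w ps qs =
     newton_sum (\<lambda>i. 2 ^ (length ps - i) * int (w choose i) *
       newton_sum (\<lambda>k. 2 ^ (length qs - k) * int ((n - i) choose k)) 0 (newton_coeffs (int i) qs))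
     0 (newton_coeffs 0 ps)"

lemma monic_poly_eq_0_iff [simp]: "monic_poly rs x = 0 \<longleftrightarrow> x \<in> set rs"
  by (auto simp: monic_poly_def prod_list_zero_iff)

text \<open>Keeps the simplifier from working below the binder when the sums are evaluated.\<close>

lemma newton_sum_weak_cong:
  "k = l \<Longrightarrow> cs = ds \<Longrightarrow> newton_sum \<beta> k cs = newton_sum \<beta> l ds"
  by simp

lemma newton_sum_0 [simp]: "newton_sum (\<lambda>j. 0) k cs = 0"
  by (induction cs arbitrary: k) auto

lemma newton_sum_cong:
  assumes "\<And>j. k \<le> j \<Longrightarrow> j < k + length cs \<Longrightarrow> \<beta> j = \<gamma> j"
  shows "newton_sum \<beta> k cs = newton_sum \<gamma> k cs"
  using assms by (induction cs arbitrary: k) auto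

lemma newton_sum_mult_left: "newton_sum (\<lambda>j. x * \<beta> j) k cs = x * newton_sum \<beta> k cs"
  by (induction cs arbitrary: k) (auto simp: algebra_simps)

lemma newton_sum_sum: "newton_sum (\<lambda>j. \<Sum>a\<in>A. \<beta> a j) k cs = (\<Sum>a\<in>A. newton_sum (\<beta> a) k cs)"
  by (induction cs arbitrary: k) (auto simp: sum.distrib sum_distrib_left)

lemma length_newton_mult: "length (newton_mult r k b cs) = Suc (length cs)"
  by (induction cs arbitrary: k b) auto

lemma length_newton_coeffs: "length (newton_coeffs s rs) = Suc (length rs)"
  by (induction rs) (auto simp: length_newton_mult)

lemma Suc_times_binomial_int:
  "int (Suc k) * int (y choose Suc k) = (int y - int k) * int (y choose k)"
proof (cases "k \<le> y")
  case True
  have "Suc k * (y choose Suc k) = (y - k) * (y choose k)"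
    by (metis Suc_times_binomial_eq binomial_absorb_comp binomial_absorption mult.commute)
  then show ?thesis using True by (metis of_nat_diff of_nat_mult)
qed (simp add: binomial_eq_0)

text \<open>The term with \<open>b\<close> lets the induction pass down the list; it vanishes at
  \<open>k = 0\<close>.\<close>

lemma newton_sum_newton_mult:
  "newton_sum (\<lambda>j. int (y choose j)) k (newton_mult r k b cs) =
     (int y - r) * newton_sum (\<lambda>j. int (y choose j)) k cs + int k * b * int (y choose k)"
proof (induction cs arbitrary: k b)
  case (Cons c cs)
  have "int (Suc k) * c * int (y choose Suc k) = c * ((int y - int k) * int (y choose k))"
    by (simp only: Suc_times_binomial_int[symmetric] mult.assoc mult.left_commute)
  then show ?case using Cons by (simp add: algebra_simps)
qed simp

lemma newton_sum_newton_coeffs: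
  "newton_sum (\<lambda>j. int (y choose j)) 0 (newton_coeffs s rs) = monic_poly rs (s + int y)"
  by (induction rs) (auto simp: newton_sum_newton_mult monic_poly_def algebra_simps)

section \<open>Self-dual codes as orthogonal arrays\<close>

lemma UNIV_bit: "(UNIV :: bit set) = {0, 1}"
  by (auto intro: bit.exhaust)

instance bit :: finite
  by standard (simp add: UNIV_bit)

section \<open>Words as subsets\<close>

definition supp :: "bit ^ 'n::finite \<Rightarrow> 'n set" where
  "supp v = {j. v $ j \<noteq> 0}"

definition word :: "'n::finite set \<Rightarrow> bit ^ 'n" where
  "word A = (\<chi> j. if j \<in> A then 1 else 0)"

text \<open>The nontrivial additive character of the field with two elements.\<close>

definition sgn_char :: "bit \<Rightarrow> int" where
  "sgn_char b = (if b = 0 then 1 else - 1)"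

lemma supp_word [simp]: "supp (word A) = A"
  by (simp add: supp_def word_def)

lemma word_supp [simp]: "word (supp v) = v"
  by (simp add: supp_def word_def vec_eq_iff)

lemma wt_eq_card_supp: "wt v = card (supp v)"
  by (simp add: wt_def supp_def)

lemma supp_eq_empty [simp]: "supp v = {} \<longleftrightarrow> v = 0"
  by (auto simp: supp_def vec_eq_iff)

lemma wt_eq_0 [simp]: "wt v = 0 \<longleftrightarrow> v = 0"
  by (simp add: wt_eq_card_supp)

lemma supp_add: "supp (u + v) = (supp u - supp v) \<union> (supp v - supp u)"
proof -
  have "x + y \<noteq> 0 \<longleftrightarrow> (x \<noteq> 0) \<noteq> (y \<noteq> 0)" for x y :: bit
    by (cases x; cases y) auto
  then show ?thesis unfolding supp_def by fastforce
qed

lemma wt_add: "wt (u + v) + 2 * card (supp u \<inter> supp v) = wt u + wt v"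
proof -
  have "card (supp (u + v)) = card (supp u - supp v) + card (supp v - supp u)"
    unfolding supp_add by (intro card_Un_disjoint) auto
  moreover have "card (supp u) = card (supp u - supp v) + card (supp u \<inter> supp v)"
    by (metis add.commute card_Int_Diff finite)
  moreover have "card (supp v) = card (supp v - supp u) + card (supp u \<inter> supp v)"
    by (metis add.commute card_Int_Diff finite Int_commute)
  ultimately show ?thesis by (simp add: wt_eq_card_supp)
qed

lemma pairing_eq_of_nat: "pairing u v = of_nat (card (supp u \<inter> supp v))"
proof -
  have "pairing u v = (\<Sum>j\<in>UNIV. if j \<in> supp u \<inter> supp v then 1 else 0)"
    unfolding pairing_def supp_def by (intro sum.cong) auto
  also have "\<dots> = of_nat (card (supp u \<inter> supp v))"
    by (simp only: sum.If_cases[OF finite])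
      (simp only: sum.neutral_const sum_constant Int_UNIV_left Collect_mem_eq mult_1_right
        add_0_right)
  finally show ?thesis .
qed

lemma of_nat_bit_eq_0: "(of_nat m :: bit) = 0 \<longleftrightarrow> even m"
  by (induction m) auto

lemma pairing_eq_0_iff: "pairing u v = 0 \<longleftrightarrow> even (card (supp u \<inter> supp v))"
  by (simp add: pairing_eq_of_nat of_nat_bit_eq_0)

lemma pairing_add_right: "pairing u (v + w) = pairing u v + pairing u w"
  by (simp only: pairing_def vector_add_component distrib_left sum.distrib)

lemma pairing_commute: "pairing u v = pairing v u"
  by (simp only: pairing_def mult.commute)

section \<open>Character sums over a code and its dual\<close>

lemma sgn_char_add: "sgn_char (a + b) = sgn_char a * sgn_char b"
  by (cases a; cases b) (auto simp: sgn_char_def)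

text \<open>If \<open>u\<close> is outside the dual, translation by some \<open>c0\<close> in
  \<open>C\<close> with \<open>pairing u c0 = 1\<close> permutes \<open>C\<close> and reverses every
  sign, so the sum equals its own negative.\<close>

lemma sum_sgn_char:
  fixes C :: "'n::finite code"
  assumes "linear_code C"
  shows "(\<Sum>c\<in>C. sgn_char (pairing u c)) = (if u \<in> dual_code C then int (card C) else 0)"
proof (cases "u \<in> dual_code C")
  case True
  then show ?thesis by (simp add: dual_code_def sgn_char_def)
next
  case False
  then obtain c0 where c0: "c0 \<in> C" "pairing u c0 = 1"
    by (auto simp: dual_code_def)
  have add: "c0 + c \<in> C" if "c \<in> C" for c
    using assms that c0 by (simp add: linear_code_def vec.subspace_add)
  have self: "c0 + (c0 + c) = c" for c
  proof -
    have "x + (x + y) = y" for x y :: bit by (cases x; cases y) auto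
    then show ?thesis by (simp add: vec_eq_iff)
  qed
  have "(\<Sum>c\<in>C. sgn_char (pairing u c)) = (\<Sum>c\<in>C. sgn_char (pairing u (c0 + c)))"
    by (rule sum.reindex_bij_witness[where i = "\<lambda>c. c0 + c" and j = "\<lambda>c. c0 + c"])
      (auto simp: add self)
  also have "\<dots> = - (\<Sum>c\<in>C. sgn_char (pairing u c))"
    by (simp only: pairing_add_right sgn_char_add c0) (simp add: sgn_char_def flip: sum_negf)
  finally show ?thesis using False by simp
qed

lemma dual_code_UNIV: "dual_code (UNIV :: 'n::finite code) = {0}"
proof -
  have "u = 0" if "\<And>v. pairing u v = 0" for u :: "bit ^ 'n"
  proof -
    have "supp u = {}"
    proof (rule ccontr)
      assume "supp u \<noteq> {}"
      then obtain j where "j \<in> supp u" by blast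
      then have "supp u \<inter> supp (word {j}) = {j}" by auto
      then show False using that[of "word {j}"] unfolding pairing_eq_0_iff by simp
    qed
    then show ?thesis by simp
  qed
  then show ?thesis by (auto simp: dual_code_def pairing_def)
qed

text \<open>Evaluates one double character sum in both orders: summing over \<open>C\<close> first
  leaves the words of the dual, summing over the whole space first leaves only
  \<open>0\<close>.\<close>

lemma card_code_times_card_dual:
  fixes C :: "'n::finite code"
  assumes "linear_code C"
  shows "card C * card (dual_code C) = 2 ^ CARD('n)"
proof -
  have 0: "0 \<in> C" using assms by (simp add: linear_code_def vec.subspace_0)
  have "CARD(bit) = 2" by (simp add: UNIV_bit)
  then have card: "CARD(bit ^ 'n) = 2 ^ CARD('n)" by simp
  have lin: "linear_code (UNIV :: 'n code)" by (simp add: linear_code_def)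
  have "int (card C * card (dual_code C)) =
      (\<Sum>u\<in>UNIV. if u \<in> dual_code C then int (card C) else 0)"
    by (subst sum.If_cases) (auto simp: mult.commute)
  also have "\<dots> = (\<Sum>u\<in>UNIV. \<Sum>c\<in>C. sgn_char (pairing u c))"
    by (simp add: sum_sgn_char assms)
  also have "\<dots> = (\<Sum>c\<in>C. \<Sum>u\<in>UNIV. sgn_char (pairing c u))"
    by (subst sum.swap) (simp add: pairing_commute)
  also have "\<dots> = (\<Sum>c\<in>C. if c = 0 then int (2 ^ CARD('n)) else 0)"
    by (simp add: sum_sgn_char[OF lin] dual_code_UNIV card del: CARD_vec)
  also have "\<dots> = int (2 ^ CARD('n))"
    using 0 by (simp add: sum.delta)
  finally show ?thesis by (simp only: of_nat_eq_iff)
qed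

lemma card_self_dual:
  fixes C :: "'n::finite code"
  assumes "type_II C" "even CARD('n)"
  shows "card C = 2 ^ (CARD('n) div 2)"
proof -
  have "card C * card C = 2 ^ CARD('n)"
    using card_code_times_card_dual[of C] assms(1) by (simp add: type_II_def)
  also have "\<dots> = 2 ^ (CARD('n) div 2) * 2 ^ (CARD('n) div 2)"
    using assms(2) by (simp flip: power_add mult_2)
  finally show ?thesis by (metis power2_eq_square power2_eq_iff_nonneg zero_le)
qed

section \<open>Codewords containing a given set, and averages of polynomials\<close>

lemma sgn_char_word:
  "sgn_char (pairing (word U) c) = (\<Prod>j\<in>U. sgn_char (c $ j))"
proof (induction U rule: infinite_finite_induct)
  case empty
  then show ?case by (simp add: pairing_eq_of_nat sgn_char_def)
next
  case (insert j U)
  have "pairing (word (insert j U)) c = (\<Sum>i\<in>insert j U. c $ i)"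
    unfolding pairing_def word_def by (intro sum.mono_neutral_cong_right) auto
  moreover have "pairing (word U) c = (\<Sum>i\<in>U. c $ i)"
    unfolding pairing_def word_def by (intro sum.mono_neutral_cong_right) auto
  ultimately show ?case using insert
    by (simp only: sum.insert prod.insert sgn_char_add not_False_eq_True)
qed simp

lemma int_card_filter_eq_sum:
  "finite A \<Longrightarrow> int (card {x \<in> A. P x}) = (\<Sum>x\<in>A. if P x then 1 else 0)"
  by (simp add: sum.If_cases Collect_conj_eq)

text \<open>The factor \<open>1 - sgn_char (c $ j)\<close> is 2 on the support and 0 off it. Its
  product over \<open>T\<close> expands into characters of words supported in \<open>T\<close>;
  these have weight below \<open>d\<close>, so only the zero word among them lies in
  \<open>C\<close> and contributes.\<close>

lemma card_codewords_containing:
  fixes C :: "'n::finite code"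
  assumes "linear_code C" "dual_code C = C"
    and "\<And>c. c \<in> C \<Longrightarrow> c \<noteq> 0 \<Longrightarrow> d \<le> wt c" "card T < d"
  shows "2 ^ card T * int (card {c \<in> C. T \<subseteq> supp c}) = int (card C)"
proof -
  have ind: "(if T \<subseteq> supp c then 1 else 0) * 2 ^ card T =
      (\<Sum>U\<in>Pow T. (- 1) ^ card U * sgn_char (pairing (word U) c))" for c
  proof -
    have "(if T \<subseteq> supp c then 1 else 0) * 2 ^ card T =
        (\<Prod>j\<in>T. if j \<in> supp c then 2 else (0::int))"
      by (auto simp: prod_zero_iff subset_iff)
    also have "\<dots> = (\<Prod>j\<in>T. - sgn_char (c $ j) + 1)"
      by (intro prod.cong) (auto simp: supp_def sgn_char_def)
    also have "\<dots> = (\<Sum>U\<in>Pow T. (- 1) ^ card U * sgn_char (pairing (word U) c))"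
      by (subst prod_add) (auto simp: sgn_char_word prod_uminus)
    finally show ?thesis .
  qed
  have zero: "(\<Sum>c\<in>C. sgn_char (pairing (word U) c)) = (if U = {} then int (card C) else 0)"
    if "U \<subseteq> T" for U
  proof -
    have "word U \<in> C \<longleftrightarrow> U = {}"
    proof
      assume "word U \<in> C"
      moreover have "wt (word U) < d"
        using card_mono[OF _ that] assms(4) by (simp add: wt_eq_card_supp)
      ultimately have "word U = 0" using assms(3) by fastforce
      then show "U = {}" by (metis supp_eq_empty supp_word)
    next
      assume "U = {}"
      then have "word U = 0" by (metis supp_eq_empty supp_word)
      then show "word U \<in> C" using assms(1) by (simp add: linear_code_def vec.subspace_0)
    qed
    then show ?thesis using assms(1,2) by (simp add: sum_sgn_char)
  qed
  have "2 ^ card T * int (card {c \<in> C. T \<subseteq> supp c}) =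
      (\<Sum>c\<in>C. (if T \<subseteq> supp c then 1 else 0) * 2 ^ card T)"
    by (simp add: int_card_filter_eq_sum flip: sum_distrib_right)
  also have "\<dots> = (\<Sum>U\<in>Pow T. (- 1) ^ card U * (\<Sum>c\<in>C. sgn_char (pairing (word U) c)))"
    unfolding ind by (subst sum.swap) (simp add: sum_distrib_left)
  also have "\<dots> = (\<Sum>U\<in>Pow T. if U = {} then int (card C) else 0)"
    by (intro sum.cong) (auto simp: zero)
  also have "\<dots> = int (card C)" by (simp add: sum.delta)
  finally show ?thesis .
qed

lemma binomial_eq_sum_subsets:
  assumes "finite A"
  shows "int (card (A \<inter> X) choose i) =
    (\<Sum>I | I \<subseteq> A \<and> card I = i. if I \<subseteq> X then 1 else 0)"
proof -
  have "card (A \<inter> X) choose i = card {I. I \<subseteq> A \<inter> X \<and> card I = i}"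
    using assms by (intro n_subsets[symmetric]) simp
  also have "{I. I \<subseteq> A \<inter> X \<and> card I = i} = {I \<in> {I. I \<subseteq> A \<and> card I = i}. I \<subseteq> X}"
    by auto
  finally show ?thesis using assms by (subst int_card_filter_eq_sum[symmetric]) auto
qed

text \<open>Counts codewords together with disjoint sets \<open>I\<close> and \<open>K\<close> in
  their support, with \<open>I\<close> inside \<open>S\<close>. Subtracting \<open>i\<close> from
  the weight keeps \<open>K\<close> away from \<open>I\<close>, so \<open>I \<union> K\<close> has
  \<open>i + k\<close> elements and lies in a fraction \<open>1 / 2 ^ (i + k)\<close> of the
  codewords.\<close>

lemma sum_binomial_binomial:
  fixes C :: "'n::finite code"
  assumes "linear_code C" "dual_code C = C"
    and "\<And>c. c \<in> C \<Longrightarrow> c \<noteq> 0 \<Longrightarrow> d \<le> wt c" "i + k < d"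
  shows "2 ^ (i + k) * (\<Sum>c\<in>C. int (card (S \<inter> supp c) choose i) * int ((wt c - i) choose k)) =
    int (card C) * (int (card S choose i) * int ((CARD('n) - i) choose k))"
proof -
  let ?I = "{I. I \<subseteq> S \<and> card I = i}"
  let ?K = "\<lambda>I. {K. K \<subseteq> - I \<and> card K = k}"
  have "int (card (S \<inter> supp c) choose i) * int ((wt c - i) choose k) =
      (\<Sum>I\<in>?I. \<Sum>K\<in>?K I. if I \<union> K \<subseteq> supp c then 1 else 0)" for c
  proof -
    have "(if I \<subseteq> supp c then 1 else 0) * int ((wt c - i) choose k) =
        (\<Sum>K\<in>?K I. if I \<union> K \<subseteq> supp c then 1 else 0)" if "I \<in> ?I" for I
    proof (cases "I \<subseteq> supp c")
      case True
      have "- I \<inter> supp c = supp c - I" by auto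
      then have "wt c - i = card (- I \<inter> supp c)"
        using that True by (simp add: wt_eq_card_supp card_Diff_subset)
      then show ?thesis using True by (simp add: binomial_eq_sum_subsets)
    qed simp
    then show ?thesis
      unfolding binomial_eq_sum_subsets[OF finite, of S] sum_distrib_right
      by (intro sum.cong refl)
  qed
  then have "(\<Sum>c\<in>C. int (card (S \<inter> supp c) choose i) * int ((wt c - i) choose k)) =
      (\<Sum>c\<in>C. \<Sum>I\<in>?I. \<Sum>K\<in>?K I. if I \<union> K \<subseteq> supp c then 1 else 0)"
    by simp
  also have "\<dots> = (\<Sum>I\<in>?I. \<Sum>K\<in>?K I. \<Sum>c\<in>C. if I \<union> K \<subseteq> supp c then 1 else 0)"
    by (subst sum.swap) (intro sum.cong refl sum.swap)
  finally have "2 ^ (i + k) *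
      (\<Sum>c\<in>C. int (card (S \<inter> supp c) choose i) * int ((wt c - i) choose k)) =
      (\<Sum>I\<in>?I. \<Sum>K\<in>?K I. 2 ^ (i + k) * (\<Sum>c\<in>C. if I \<union> K \<subseteq> supp c then 1 else 0))"
    by (simp only: sum_distrib_left)
  also have "\<dots> = (\<Sum>I\<in>?I. \<Sum>K\<in>?K I. int (card C))"
  proof (intro sum.cong refl)
    fix I K assume I: "I \<in> ?I" and K: "K \<in> ?K I"
    have "card (I \<union> K) = i + k"
      using I K by (subst card_Un_disjoint) auto
    then show "2 ^ (i + k) * (\<Sum>c\<in>C. if I \<union> K \<subseteq> supp c then 1 else 0) = int (card C)"
      using card_codewords_containing[of C d "I \<union> K"] assms
      by (simp flip: int_card_filter_eq_sum[OF finite])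
  qed
  also have "\<dots> = (\<Sum>I\<in>?I. int ((CARD('n) - i) choose k) * int (card C))"
    by (intro sum.cong refl) (auto simp: n_subsets Compl_eq_Diff_UNIV card_Diff_subset)
  also have "\<dots> = int (card C) * (int (card S choose i) * int ((CARD('n) - i) choose k))"
    by (simp add: n_subsets)
  finally show ?thesis .
qed

lemma sum_monic_poly:
  fixes C :: "'n::finite code"
  assumes "linear_code C" "dual_code C = C"
    and "\<And>c. c \<in> C \<Longrightarrow> c \<noteq> 0 \<Longrightarrow> d \<le> wt c" "length ps + length qs < d"
  shows "2 ^ (length ps + length qs) *
      (\<Sum>c\<in>C. monic_poly ps (card (S \<inter> supp c)) * monic_poly qs (wt c)) =
    int (card C) * moment CARD('n) (card S) ps qs"
proof -
  let ?a = "\<lambda>c. card (S \<inter> supp c)"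
  let ?p = "length ps" and ?q = "length qs"
  have inner: "2 ^ (?p + ?q) * (\<Sum>c\<in>C. int (?a c choose i) * monic_poly qs (wt c)) =
      int (card C) * (2 ^ (?p - i) * int (card S choose i) * newton_sum
        (\<lambda>k. 2 ^ (?q - k) * int ((CARD('n) - i) choose k)) 0 (newton_coeffs (int i) qs))"
    (is "_ = ?rhs") if i: "i \<le> ?p" for i
  proof -
    have "int (?a c choose i) * monic_poly qs (wt c) = newton_sum
        (\<lambda>k. int (?a c choose i) * int ((wt c - i) choose k)) 0 (newton_coeffs (int i) qs)" for c
    \<comment> \<open>Truncation in \<open>wt c - i\<close> does harm only for
      \<open>i > wt c\<close>, hence \<open>i > ?a c\<close>, where the first binomial
      vanishes.\<close>
    proof (cases "i \<le> ?a c")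
      case True
      have "?a c \<le> wt c" by (simp add: wt_eq_card_supp card_mono)
      with True have "int i + int (wt c - i) = int (wt c)" by simp
      then show ?thesis by (simp only: newton_sum_mult_left newton_sum_newton_coeffs)
    next
      case False
      then have "int (?a c choose i) = 0" by (simp add: binomial_eq_0)
      then show ?thesis by (simp only: mult_zero_left newton_sum_0)
    qed
    then have "2 ^ (?p + ?q) * (\<Sum>c\<in>C. int (?a c choose i) * monic_poly qs (wt c)) = newton_sum
        (\<lambda>k. 2 ^ (?p + ?q) * (\<Sum>c\<in>C. int (?a c choose i) * int ((wt c - i) choose k))) 0
        (newton_coeffs (int i) qs)"
      by (simp only: newton_sum_sum newton_sum_mult_left)
    also have "\<dots> = newton_sum (\<lambda>k. (int (card C) * (2 ^ (?p - i) * int (card S choose i))) *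
        (2 ^ (?q - k) * int ((CARD('n) - i) choose k))) 0 (newton_coeffs (int i) qs)"
    proof (rule newton_sum_cong)
      fix k assume "k < 0 + length (newton_coeffs (int i) qs)"
      then have k: "k \<le> ?q" by (simp add: length_newton_coeffs)
      \<comment> \<open>One fixed power of two clears every denominator
        \<open>2 ^ (i + k)\<close>.\<close>
      have pow: "(2::int) ^ (?p + ?q) = 2 ^ (?p - i) * 2 ^ (?q - k) * 2 ^ (i + k)"
        using i k by (simp flip: power_add)
      have design: "2 ^ (i + k) *
          (\<Sum>c\<in>C. int (?a c choose i) * int ((wt c - i) choose k)) =
          int (card C) * (int (card S choose i) * int ((CARD('n) - i) choose k))"
        using assms i k by (intro sum_binomial_binomial[where d = d]) auto
      show "2 ^ (?p + ?q) *
          (\<Sum>c\<in>C. int (?a c choose i) * int ((wt c - i) choose k)) =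
          (int (card C) * (2 ^ (?p - i) * int (card S choose i))) *
          (2 ^ (?q - k) * int ((CARD('n) - i) choose k))"
        by (simp only: pow mult.assoc design) (simp only: mult_ac)
    qed
    also have "\<dots> = ?rhs" by (simp only: newton_sum_mult_left mult.assoc)
    finally show ?thesis .
  qed
  have "monic_poly ps (?a c) * monic_poly qs (wt c) = newton_sum
      (\<lambda>i. int (?a c choose i) * monic_poly qs (wt c)) 0 (newton_coeffs 0 ps)" for c
    using newton_sum_mult_left[of "monic_poly qs (wt c)" "\<lambda>i. int (?a c choose i)" 0
        "newton_coeffs 0 ps"]
      newton_sum_newton_coeffs[of "?a c" 0 ps]
    by (simp add: mult.commute)
  then have "2 ^ (?p + ?q) * (\<Sum>c\<in>C. monic_poly ps (?a c) * monic_poly qs (wt c)) = newton_sum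
      (\<lambda>i. 2 ^ (?p + ?q) * (\<Sum>c\<in>C. int (?a c choose i) * monic_poly qs (wt c))) 0
      (newton_coeffs 0 ps)"
    by (simp only: newton_sum_sum newton_sum_mult_left)
  also have "\<dots> = int (card C) * moment CARD('n) (card S) ps qs"
    unfolding moment_def newton_sum_mult_left[symmetric, of "int (card C)"]
    by (intro newton_sum_cong, subst inner) (simp_all add: length_newton_coeffs)
  finally show ?thesis .
qed

section \<open>Coset representatives of minimal weight\<close>

text \<open>All weights are even, so the all-one word is orthogonal to \<open>C\<close>, and
  self-duality puts it in \<open>C\<close>.\<close>

lemma one_word_in_code:
  fixes C :: "'n::finite code"
  assumes "type_II C"
  shows "word UNIV \<in> C"
proof -
  have "pairing (word UNIV) c = 0" if "c \<in> C" for c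
  proof -
    have "4 dvd wt c" using assms that by (auto simp: type_II_def)
    then have "even (wt c)" by presburger
    then show ?thesis by (simp add: pairing_eq_0_iff wt_eq_card_supp)
  qed
  then have "word UNIV \<in> dual_code C" by (simp add: dual_code_def)
  then show ?thesis using assms by (simp add: type_II_def)
qed

text \<open>Adding the all-one word complements the support, and the complementary weight is 0 or at
  least \<open>d\<close>.\<close>

lemma type_II_weight_gap:
  fixes C :: "'n::finite code"
  assumes "type_II C" "\<And>c. c \<in> C \<Longrightarrow> c \<noteq> 0 \<Longrightarrow> d \<le> wt c" "c \<in> C" "c \<noteq> 0"
  shows "wt c = CARD('n) \<or> (4 dvd wt c \<and> d \<le> wt c \<and> wt c + d \<le> CARD('n))"
proof -
  have sum: "wt (c + word UNIV) + 2 * wt c = wt c + CARD('n)"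
    using wt_add[of c "word UNIV"] by (simp add: wt_eq_card_supp)
  have "c + word UNIV \<in> C"
    using assms one_word_in_code[OF assms(1)]
    by (intro vec.subspace_add) (auto simp: type_II_def linear_code_def)
  then have "wt (c + word UNIV) = 0 \<or> d \<le> wt (c + word UNIV)"
    using assms(2) by auto
  moreover have "4 dvd wt c" "d \<le> wt c"
    using assms by (auto simp: type_II_def)
  ultimately show ?thesis using sum by linarith
qed

text \<open>Separates the coding argument from the arithmetic: \<open>qs\<close> and
  \<open>ps\<close> hold the required roots, and in \<open>num\<close> the number \<open>w\<close>
  is a possible weight of the minimal word \<open>c\<close>.\<close>

lemma eq_weight_subcode:
  fixes C :: "'n::finite code"
  assumes C: "type_II C" and d: "\<And>c. c \<in> C \<Longrightarrow> c \<noteq> 0 \<Longrightarrow> d \<le> wt c"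
    and n: "even CARD('n)"
    and weights: "\<And>w. 4 dvd w \<Longrightarrow> d < w \<Longrightarrow> w + d \<le> CARD('n) \<Longrightarrow> int w \<in> set qs"
    and ps: "\<And>a. even a \<Longrightarrow> 2 * a \<le> d \<Longrightarrow> int a \<in> set ps"
    and len: "length ps + length qs < d"
    and num: "\<And>w. w = CARD('n) \<or> int w \<in> set qs \<Longrightarrow>
      2 ^ (length ps + length qs) * (monic_poly ps w * monic_poly qs CARD('n)) \<noteq>
        2 ^ (CARD('n) div 2) * moment CARD('n) w ps qs"
  shows "C = weight_subcode C d"
proof (rule ccontr)
  let ?W = "weight_subcode C d"
  have lin: "linear_code C" and dual: "dual_code C = C" using C by (auto simp: type_II_def)
  have "?W \<subseteq> C"
    unfolding weight_subcode_def
    using lin by (intro vec.span_minimal) (auto simp: words_of_weight_def linear_code_def)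
  moreover assume "C \<noteq> ?W"
  ultimately obtain c' where "c' \<in> C - ?W" by blast
  define c where "c = arg_min wt (\<lambda>c. c \<in> C - ?W)"
  have c: "c \<in> C" "c \<notin> ?W" and c_min: "\<And>v. v \<in> C \<Longrightarrow> v \<notin> ?W \<Longrightarrow> wt c \<le> wt v"
    using arg_min_nat_lemma[of "\<lambda>c. c \<in> C - ?W" c' wt] \<open>c' \<in> C - ?W\<close> unfolding c_def by auto
  have "c \<noteq> 0" using c(2) by (auto simp: weight_subcode_def vec.span_zero)
  moreover have "wt c \<noteq> d"
    using c by (auto simp: weight_subcode_def words_of_weight_def intro: vec.span_base)
  ultimately have wtc: "wt c = CARD('n) \<or> int (wt c) \<in> set qs"
    using type_II_weight_gap[OF C d c(1)] weights[of "wt c"] by fastforce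
  have zero: "monic_poly ps (card (supp c \<inter> supp v)) * monic_poly qs (wt v) = 0"
    if v: "v \<in> C" "v \<noteq> word UNIV" for v
  proof (cases "v = 0")
    case True
    then have "supp v = {}" by simp
    then have "card (supp c \<inter> supp v) = 0" by (simp only: Int_empty_right card.empty)
    then have "monic_poly ps (card (supp c \<inter> supp v)) = 0" using ps[of 0] by simp
    then show ?thesis by simp
  next
    case False
    have "wt v \<noteq> CARD('n)"
    proof
      assume "wt v = CARD('n)"
      then have "supp v = UNIV" by (simp add: wt_eq_card_supp card_eq_UNIV_imp_eq_UNIV)
      then show False using v(2) by (metis word_supp)
    qed
    then consider "wt v = d" | "int (wt v) \<in> set qs"
      using type_II_weight_gap[OF C d v(1) False] weights[of "wt v"] by fastforce
    then show ?thesis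
    proof cases
      case 1
      then have vW: "v \<in> ?W"
        using v by (auto simp: weight_subcode_def words_of_weight_def intro: vec.span_base)
      \<comment> \<open>Since \<open>v\<close> is in the span, \<open>c + v\<close> stays in the
        coset of \<open>c\<close>, so minimality of \<open>c\<close> applies to it.\<close>
      have "c + v \<notin> ?W"
        using vec.span_diff[of "c + v" _ v] vW c(2) unfolding weight_subcode_def
        by (metis add_diff_cancel_right')
      moreover have "c + v \<in> C"
        using c(1) v(1) lin by (simp add: linear_code_def vec.subspace_add)
      ultimately have "wt c \<le> wt (c + v)" using c_min by blast
      then have "2 * card (supp c \<inter> supp v) \<le> d"
        using wt_add[of c v] 1 by linarith
      moreover have "even (card (supp c \<inter> supp v))"
        using c(1) v(1) dual pairing_eq_0_iff by (auto simp: dual_code_def)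
      ultimately have "int (card (supp c \<inter> supp v)) \<in> set ps" using ps by blast
      then show ?thesis by simp
    next
      case 2
      then show ?thesis by simp
    qed
  qed
  have "2 ^ (CARD('n) div 2) * moment CARD('n) (wt c) ps qs =
      2 ^ (length ps + length qs) *
        (\<Sum>v\<in>C. monic_poly ps (card (supp c \<inter> supp v)) * monic_poly qs (wt v))"
    using sum_monic_poly[OF lin dual d len, of "supp c"] card_self_dual[OF C n]
    by (simp add: wt_eq_card_supp)
  also have "(\<Sum>v\<in>C. monic_poly ps (card (supp c \<inter> supp v)) * monic_poly qs (wt v)) =
      (\<Sum>v\<in>{word UNIV}. monic_poly ps (card (supp c \<inter> supp v)) * monic_poly qs (wt v))"
    using one_word_in_code[OF C] zero by (intro sum.mono_neutral_right) auto
  also have "\<dots> = monic_poly ps (wt c) * monic_poly qs CARD('n)"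
    by (simp add: wt_eq_card_supp)
  finally show False using num[OF wtc] by simp
qed

text \<open>The exponent \<open>10 = 4 + 6\<close> counts the roots and is below 12; the code has
  \<open>2 ^ 24\<close> words. The weight 48 is included because \<open>c\<close> may be the all-one
  word.\<close>

lemma moment_48:
  "\<forall>w\<in>set [16, 20, 24, 28, 32, 36, 48].
     2 ^ 10 * (monic_poly [0, 2, 4, 6] (int w) * monic_poly [16, 20, 24, 28, 32, 36] 48) \<noteq>
       2 ^ 24 * moment 48 w [0, 2, 4, 6] [16, 20, 24, 28, 32, 36]"
  by (simp add: monic_poly_def moment_def binomial_code fold_atLeastAtMost_nat.simps fact_numeral
      flip: numeral_2_eq_2 cong: newton_sum_weak_cong)
text \<open>Here \<open>15 = 5 + 10\<close> roots are used, the most that the strength allows for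
  minimal weight 16; the code has \<open>2 ^ 36\<close> words.\<close>

lemma moment_72:
  "\<forall>w\<in>set [20, 24, 28, 32, 36, 40, 44, 48, 52, 56, 72].
     2 ^ 15 * (monic_poly [0, 2, 4, 6, 8] (int w) *
       monic_poly [20, 24, 28, 32, 36, 40, 44, 48, 52, 56] 72) \<noteq>
       2 ^ 36 * moment 72 w [0, 2, 4, 6, 8] [20, 24, 28, 32, 36, 40, 44, 48, 52, 56]"
  by (simp add: monic_poly_def moment_def binomial_code fold_atLeastAtMost_nat.simps fact_numeral
      flip: numeral_2_eq_2 cong: newton_sum_weak_cong)

theorem theorem9p2:
  fixes C :: "(bit ^ 'n::finite) set" and w0 :: nat
  assumes "CARD('n) = 48 \<or> CARD('n) = 72"
    and "extremal_type_II C"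
    and "w0 = min_weight C"
  shows "(CARD('n) = 48 \<longrightarrow> w0 = 12) \<and> (CARD('n) = 72 \<longrightarrow> w0 = 16) \<and> C = weight_subcode C w0"
proof -
  have C: "type_II C" and w0: "w0 = 4 * (CARD('n) div 24) + 4"
    using assms(2,3) by (auto simp: extremal_type_II_def)
  have min: "w0 \<le> wt c" if "c \<in> C" "c \<noteq> 0" for c
    unfolding assms(3) min_weight_def using that by (intro wellorder_Inf_le1) auto
  from assms(1) have "C = weight_subcode C w0"
  proof
    assume n: "CARD('n) = 48"
    then have "w0 = 12" using w0 by simp
    with min have d: "\<And>c. c \<in> C \<Longrightarrow> c \<noteq> 0 \<Longrightarrow> 12 \<le> wt c" by simp
    have "C = weight_subcode C 12"
    \<comment> \<open>\<open>qs\<close> lists the multiples of 4 above 12 up to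
      \<open>48 - 12\<close>, and \<open>ps\<close> the even numbers up to
      \<open>12 / 2\<close>.\<close>
    proof (rule eq_weight_subcode[where qs = "[16, 20, 24, 28, 32, 36]" and ps = "[0, 2, 4, 6]"])
      fix w assume "w = CARD('n) \<or> int w \<in> set [16, 20, 24, 28, 32, 36]"
      then show "2 ^ (length [0, 2, 4, 6 :: int] + length [16, 20, 24, 28, 32, 36 :: int]) *
          (monic_poly [0, 2, 4, 6] (int w) * monic_poly [16, 20, 24, 28, 32, 36] (int CARD('n))) \<noteq>
          2 ^ (CARD('n) div 2) * moment CARD('n) w [0, 2, 4, 6] [16, 20, 24, 28, 32, 36]"
        using moment_48 unfolding n by auto
    next
      fix w :: nat assume "4 dvd w" "12 < w" "w + 12 \<le> CARD('n)"
      then have "w \<in> {16, 20, 24, 28, 32, 36}" unfolding n insert_iff empty_iff by presburger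
      then show "int w \<in> set [16, 20, 24, 28, 32, 36]" by auto
    next
      fix a :: nat assume "even a" "2 * a \<le> 12"
      then have "a \<in> {0, 2, 4, 6}" unfolding insert_iff empty_iff by presburger
      then show "int a \<in> set [0, 2, 4, 6]" by auto
    qed (use C d n in auto)
    then show ?thesis using \<open>w0 = 12\<close> by simp
  next
    assume n: "CARD('n) = 72"
    then have "w0 = 16" using w0 by simp
    with min have d: "\<And>c. c \<in> C \<Longrightarrow> c \<noteq> 0 \<Longrightarrow> 16 \<le> wt c" by simp
    let ?qs = "[20, 24, 28, 32, 36, 40, 44, 48, 52, 56] :: int list"
    have "C = weight_subcode C 16"
    \<comment> \<open>The lists now end at \<open>56 = 72 - 16\<close> and
      \<open>8 = 16 / 2\<close>.\<close>
    proof (rule eq_weight_subcode[where qs = ?qs and ps = "[0, 2, 4, 6, 8]"])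
      fix w assume "w = CARD('n) \<or> int w \<in> set ?qs"
      then show "2 ^ (length [0, 2, 4, 6, 8 :: int] + length ?qs) *
          (monic_poly [0, 2, 4, 6, 8] (int w) * monic_poly ?qs (int CARD('n))) \<noteq>
          2 ^ (CARD('n) div 2) * moment CARD('n) w [0, 2, 4, 6, 8] ?qs"
        using moment_72 unfolding n by auto
    next
      fix w :: nat assume "4 dvd w" "16 < w" "w + 16 \<le> CARD('n)"
      then have "w \<in> {20, 24, 28, 32, 36, 40, 44, 48, 52, 56}"
        unfolding n insert_iff empty_iff by presburger
      then show "int w \<in> set ?qs" by auto
    next
      fix a :: nat assume "even a" "2 * a \<le> 16"
      then have "a \<in> {0, 2, 4, 6, 8}" unfolding insert_iff empty_iff by presburger
      then show "int a \<in> set [0, 2, 4, 6, 8]" by auto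
    qed (use C d n in auto)
    then show ?thesis using \<open>w0 = 16\<close> by simp
  qed
  with w0 show ?thesis by auto
qed

end
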